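(* Let $m,n,N\ge 1$, let $W,W^\star,G\in\mathbb{R}^{m\times n}$, $Z\in\mathbb{R}^{n\times N}$, and $H\in\mathbb{R}^{m\times m}$ symmetric. Assume that $H\succ 0$, $ZZ^\top\succ 0$ and $$G=\tfrac1N\,H\,(W-W^\star)\,ZZ^\top .$$ Assume moreover that $\Sigma_W:=(W-W^\star)(W-W^\star)^\top$ satisfies $\Sigma_W\propto I_m$. Let $Q^\star$ be the unique minimizer over $Q\in\mathbb{R}^{m\times n}$ of $$J(Q)=-\mathrm{tr}(QG^\top)+\frac{1}{2N}\mathrm{tr}\big(H\,Q\,ZZ^\top Q^\top\big).$$ Then $$Q^\star\propto \mathrm{msgn}\big(G(ZZ^\top)^{-1}\big).$$
   Context: For a real matrix $X$ with compact singular value decomposition $X=USV^\top$ ($U,V$ with orthonormal columns, $S$ diagonal with positive entries, of size $\mathrm{rank}(X)$), the matrix sign is $\mathrm{msgn}(X):=UV^\top$, with $\mathrm{msgn}(0)=0$. For matrices $A,B$ of the same size, $A\propto B$ means $A=cB$ for some scalar $c>0$. $A\succ0$ means symmetric positive definite. *)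

theory Defs
  imports "HOL-Analysis.Analysis"
begin

definition propto :: "real^'n^'m \<Rightarrow> real^'n^'m \<Rightarrow> bool" (infix "\<propto>" 50) where
  "A \<propto> B \<longleftrightarrow> (\<exists>c>0. A = c *\<^sub>R B)"

definition pos_def :: "real^'n^'n \<Rightarrow> bool" where
  "pos_def A \<longleftrightarrow> transpose A = A \<and> (\<forall>x. x \<noteq> 0 \<longrightarrow> x \<bullet> (A *v x) > 0)"

definition orthonormal_cols :: "nat \<Rightarrow> (nat \<Rightarrow> real^'m) \<Rightarrow> bool" where
  "orthonormal_cols r u \<longleftrightarrow> (\<forall>k<r. \<forall>l<r. u k \<bullet> u l = (if k = l then 1 else 0))"

text \<open>
  The inner dimension of a compact singular value decomposition is the rank of the matrix, which
  cannot be the index type of a column. Hence a matrix with \<open>r\<close> columns is given here by its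
  columns \<open>u 0, \<dots>, u (r - 1)\<close>, and a diagonal matrix of size \<open>r\<close> by its diagonal entries
  \<open>s 0, \<dots>, s (r - 1)\<close>.
\<close>

definition compact_svd ::
    "real^'n^'m \<Rightarrow> (nat \<Rightarrow> real^'m) \<Rightarrow> (nat \<Rightarrow> real) \<Rightarrow> (nat \<Rightarrow> real^'n) \<Rightarrow> bool" where
  "compact_svd X u s v \<longleftrightarrow>
     orthonormal_cols (rank X) u \<and> orthonormal_cols (rank X) v \<and>
     (\<forall>k<rank X. s k > 0) \<and>
     X = (\<chi> i j. \<Sum>k<rank X. u k $ i * s k * v k $ j)"

text \<open>
  The factors of a compact singular value decomposition are not unique, but the product of the
  two orthonormal ones is, which justifies the definite description.
\<close>

definition msgn :: "real^'n^'m \<Rightarrow> real^'n^'m" where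
  "msgn X = (THE M. \<exists>u s v. compact_svd X u s v \<and>
                            M = (\<chi> i j. \<Sum>k<rank X. u k $ i * v k $ j))"

lemma msgn_zero: "msgn (0 :: real^'n^'m) = 0"
proof -
  have r: "rank (0 :: real^'n^'m) = 0"
    by (simp add: rank_0)
  have z: "(\<chi> i j. 0) = (0 :: real^'n^'m)"
    by (simp add: vec_eq_iff)
  show ?thesis
    unfolding msgn_def compact_svd_def orthonormal_cols_def r
    by (simp add: z)
qed

definition quad_obj ::
    "real^'m^'m \<Rightarrow> real^'N^'n \<Rightarrow> real^'n^'m \<Rightarrow> real^'n^'m \<Rightarrow> real" where
  "quad_obj H Z G Q =
     - trace (Q ** transpose G)
     + 1 / (2 * real CARD('N)) * trace (H ** Q ** (Z ** transpose Z) ** transpose Q)"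

end

theory Submission
  imports Defs
begin

text \<open>
  Put \<open>D = W - Wstar\<close> and \<open>A = Z Z\<^sup>T\<close>. Completing the square gives
  \<open>J(Q) - J(D) = tr (H (Q - D) A (Q - D)\<^sup>T) / (2 N)\<close>, so \<open>D\<close> is the unique minimizer. On the other
  hand \<open>G A\<^sup>-\<^sup>1 = H D / N\<close>, and isotropy says that \<open>D\<close> is a positive multiple of a matrix
  with orthonormal rows. Hence \<open>H D / N\<close> is already given in polar form, its positive definite factor
  being a multiple of \<open>H\<close>, and its sign is the other factor, a multiple of \<open>D\<close>.
\<close>

subsection \<open>Matrix algebra\<close>

lemma scaleR_matrix_mult:
  fixes A :: "real^'n^'m" and B :: "real^'k^'n"
  shows "(c *\<^sub>R A) ** B = c *\<^sub>R (A ** B)" "A ** (c *\<^sub>R B) = c *\<^sub>R (A ** B)"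
  by (simp_all add: scalar_matrix_assoc matrix_scalar_ac)

lemma matrix_diff_mult:
  fixes A B :: "real^'n^'m" and C :: "real^'k^'n" and E :: "real^'m^'k"
  shows "(A - B) ** C = A ** C - B ** C" "E ** (A - B) = E ** A - E ** B"
  by (simp_all add: matrix_matrix_mult_def vec_eq_iff algebra_simps sum_subtractf)

lemma transpose_diff: "transpose (A - B) = transpose A - transpose (B :: real^'n^'m)"
  by (simp add: transpose_def vec_eq_iff)

lemma trace_scaleR: "trace (c *\<^sub>R A) = c * trace (A :: real^'n^'n)"
  by (simp add: trace_def sum_distrib_left)

lemma trace_transpose: "trace (transpose A) = trace (A :: real^'n^'n)"
  by (simp add: trace_def transpose_def)

lemma inner_matrix_vector: "x \<bullet> (A *v y) = (transpose A *v x) \<bullet> (y :: real^'n)"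
  by (simp add: dot_lmul_matrix)

lemma trace_quadratic_form:
  fixes B :: "real^'n^'m" and H :: "real^'m^'m"
  shows "trace (transpose B ** H ** B) = (\<Sum>j\<in>UNIV. column j B \<bullet> (H *v column j B))"
  unfolding matrix_mul_assoc[symmetric]
  by (simp add: trace_def matrix_matrix_mult_def transpose_def column_def inner_vec_def
      matrix_vector_mult_def)

lemma pos_def_nonneg: "pos_def H \<Longrightarrow> 0 \<le> x \<bullet> (H *v x)"
  unfolding pos_def_def by (cases "x = 0") (auto intro: less_imp_le)

lemma columns_zero_imp_zero: "(\<And>j. column j B = 0) \<Longrightarrow> B = (0 :: real^'n^'m)"
  by (simp add: column_def vec_eq_iff)

text \<open>By \<open>trace_quadratic_form\<close> the trace is a sum of nonnegative terms, one for
  each column of \<open>B\<close>, so it can vanish only if every column does.\<close>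

lemma pos_def_trace:
  fixes B :: "real^'n^'m"
  assumes "pos_def H"
  shows "0 \<le> trace (transpose B ** H ** B)"
    and "trace (transpose B ** H ** B) = 0 \<Longrightarrow> B = 0"
proof -
  show "0 \<le> trace (transpose B ** H ** B)"
    unfolding trace_quadratic_form by (intro sum_nonneg pos_def_nonneg[OF assms])
  assume "trace (transpose B ** H ** B) = 0"
  then have "column j B \<bullet> (H *v column j B) = 0" for j
    unfolding trace_quadratic_form
    by (subst (asm) sum_nonneg_eq_0_iff) (auto intro: pos_def_nonneg[OF assms])
  then show "B = 0"
    using assms unfolding pos_def_def by (intro columns_zero_imp_zero) (metis less_irrefl)
qed

lemma pos_def_invertible:
  assumes "pos_def A"
  shows "invertible A"
proof -
  have "A *v x = 0 \<Longrightarrow> x = 0" for x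
    using assms unfolding pos_def_def by (metis inner_zero_right less_irrefl)
  then show ?thesis
    unfolding invertible_left_inverse matrix_left_invertible_ker by blast
qed

lemma pos_def_scaleR:
  assumes "pos_def A" "0 < c"
  shows "pos_def (c *\<^sub>R A)"
  using assms unfolding pos_def_def
  by (simp add: transpose_scalar scaleR_matrix_vector_assoc[symmetric])

lemma invertible_mult_left_cancel:
  fixes A :: "real^'m^'m" and B C :: "real^'n^'m"
  assumes "invertible A" "A ** B = A ** C"
  shows "B = C"
proof -
  obtain A' where "A' ** A = mat 1"
    using assms(1) unfolding invertible_def by blast
  then show ?thesis
    using arg_cong[OF assms(2), of "(**) A'"] by (simp add: matrix_mul_assoc)
qed

lemma invertible_matrix_inv_right:
  fixes A :: "real^'n^'n"
  assumes "invertible A"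
  shows "A ** matrix_inv A = mat 1"
  using assms unfolding invertible_def matrix_inv_def by (rule someI2_ex) auto

text \<open>
  With \<open>E = P - H\<close> one has \<open>E P + H E = 0\<close>; multiplying by \<open>E\<close> makes two nonnegative traces sum
  to zero.
\<close>

lemma psd_sqrt_unique:
  fixes P H :: "real^'m^'m"
  assumes P_sym: "transpose P = P" and P_nonneg: "\<And>x. 0 \<le> x \<bullet> (P *v x)"
    and H: "pos_def H" and eq: "P ** P = H ** H"
  shows "P = H"
proof -
  define E where "E = P - H"
  have E_sym: "transpose E = E"
    using H P_sym by (simp add: E_def transpose_diff pos_def_def)
  have "E ** P = - (H ** E)"
    using eq by (simp add: E_def matrix_diff_mult)
  then have "trace (E ** P ** E) = trace (- (H ** E) ** E)"
    by simp
  also have "\<dots> = - trace (H ** E ** E)"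
    using scaleR_matrix_mult(1)[of "-1" "H ** E" E] trace_scaleR[of "-1" "H ** E ** E"] by simp
  also have "trace (H ** E ** E) = trace (transpose E ** H ** E)"
    by (metis E_sym matrix_mul_assoc trace_mul_sym)
  finally have "trace (transpose E ** P ** E) = - trace (transpose E ** H ** E)"
    by (simp add: E_sym)
  moreover have "0 \<le> trace (transpose E ** P ** E)"
    unfolding trace_quadratic_form by (intro sum_nonneg P_nonneg)
  ultimately have "E = 0"
    using pos_def_trace[OF H, of E] by linarith
  then show ?thesis
    by (simp add: E_def)
qed

subsection \<open>The spectral theorem for symmetric matrices\<close>

lemma orthonormal_cols_independent:
  assumes "orthonormal_cols r u"
  shows "independent (u ` {..<r})" "card (u ` {..<r}) = r"
proof -
  have u: "u k \<bullet> u l = (if k = l then 1 else 0)" if "k < r" "l < r" for k l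
    using assms that unfolding orthonormal_cols_def by blast
  show "independent (u ` {..<r})"
  proof (rule pairwise_orthogonal_independent)
    show "pairwise orthogonal (u ` {..<r})"
      unfolding pairwise_def orthogonal_def using u by auto
    show "0 \<notin> u ` {..<r}"
      using u by (metis imageE inner_zero_left lessThan_iff zero_neq_one)
  qed
  have "inj_on u {..<r}"
    unfolding inj_on_def using u by (metis lessThan_iff zero_neq_one)
  then show "card (u ` {..<r}) = r"
    by (simp add: card_image)
qed

text \<open>Fewer vectors than the dimension span a proper subspace, and a nonzero vector orthogonal
  to that subspace can be normalized.\<close>

lemma orthonormal_cols_extend:
  fixes u :: "nat \<Rightarrow> real^'m"
  assumes "orthonormal_cols r u" "r < CARD('m)"
  obtains x where "norm x = 1" "\<And>l. l < r \<Longrightarrow> x \<bullet> u l = 0"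
proof -
  have "dim (span (u ` {..<r})) \<le> r"
    using dim_le_card'[of "u ` {..<r}"] card_image_le[of "{..<r}" u] by simp
  then have "span (u ` {..<r}) \<noteq> (UNIV :: (real^'m) set)"
    using assms(2) by (metis dim_UNIV DIM_cart DIM_real mult.right_neutral not_le)
  then obtain a where a: "a \<noteq> 0" "\<And>x. x \<in> span (u ` {..<r}) \<Longrightarrow> a \<bullet> x = 0"
    using span_not_UNIV_orthogonal by blast
  show thesis
  proof (rule that[of "a /\<^sub>R norm a"])
    show "norm (a /\<^sub>R norm a) = 1"
      using a(1) by simp
    show "(a /\<^sub>R norm a) \<bullet> u l = 0" if "l < r" for l
      using a(2)[of "u l"] that by (simp add: span_base)
  qed
qed

text \<open>Independence and the dimension count make the \<open>u l\<close> span the whole space,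
  so \<open>x\<close> is orthogonal to itself.\<close>

lemma orthonormal_cols_orthogonal_zero:
  fixes u :: "nat \<Rightarrow> real^'m"
  assumes "orthonormal_cols CARD('m) u" "\<And>l. l < CARD('m) \<Longrightarrow> x \<bullet> u l = 0"
  shows "x = 0"
proof -
  have "span (u ` {..<CARD('m)}) = (UNIV :: (real^'m) set)"
    using card_ge_dim_independent[of "u ` {..<CARD('m)}" UNIV]
      orthonormal_cols_independent[OF assms(1)] by auto
  then have "x \<in> span (u ` {..<CARD('m)})"
    by simp
  then have "orthogonal x x"
    by (rule orthogonal_to_span) (use assms(2) in \<open>auto simp: orthogonal_def\<close>)
  then show ?thesis
    by (simp add: orthogonal_def)
qed

text \<open>First-order condition for the minimum at \<open>t = 0\<close>, in a form free of
  derivatives. It is applied to a perturbed Rayleigh quotient.\<close>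

lemma linear_term_zero:
  fixes b c :: real
  assumes "\<And>t. 0 \<le> 2 * t * b + t\<^sup>2 * c"
  shows "b = 0"
proof (rule ccontr)
  assume "b \<noteq> 0"
  \<comment> \<open>Since \<open>d\<close> is positive and exceeds \<open>c\<close>, the choice
    \<open>t = - b / d\<close> gives the value \<open>(b / d)\<^sup>2 * (c - 2 * d)\<close>, which
    is negative.\<close>
  define d where "d = \<bar>c\<bar> + 1"
  have "d > 0" "c < d" by (auto simp: d_def)
  have "0 \<le> 2 * (- b / d) * b + (- b / d)\<^sup>2 * c"
    by (rule assms)
  also have "\<dots> = (b / d)\<^sup>2 * (c - 2 * d)"
    using \<open>d > 0\<close> by (simp add: field_simps power2_eq_square)
  also have "\<dots> < 0"
    using \<open>b \<noteq> 0\<close> \<open>d > 0\<close> \<open>c < d\<close> by (intro mult_pos_neg) auto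
  finally show False
    by simp
qed

text \<open>The eigenvector is a maximizer of the Rayleigh quotient on the orthogonal complement.\<close>

lemma eigenvector_extend:
  fixes u :: "nat \<Rightarrow> real^'m" and A :: "real^'m^'m"
  assumes A_sym: "transpose A = A"
    and u: "orthonormal_cols r u" "r < CARD('m)"
    and eig: "\<And>k. k < r \<Longrightarrow> A *v u k = \<mu> k *\<^sub>R u k"
  obtains x \<nu> where "norm x = 1" "\<And>l. l < r \<Longrightarrow> x \<bullet> u l = 0" "A *v x = \<nu> *\<^sub>R x"
proof -
  have sym: "x \<bullet> (A *v y) = y \<bullet> (A *v x)" for x y
    by (metis A_sym inner_commute inner_matrix_vector)
  define T where "T = {x. \<forall>l<r. x \<bullet> u l = 0}"
  define K where "K = T \<inter> sphere 0 1"
  have T_closed: "closed T"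
  proof -
    have "T = (\<Inter>l\<in>{..<r}. {x. u l \<bullet> x = 0})"
      by (auto simp: T_def inner_commute)
    then show ?thesis
      by (auto intro: closed_hyperplane)
  qed
  have "compact K"
    unfolding K_def by (rule closed_Int_compact[OF T_closed]) simp
  moreover have "K \<noteq> {}"
  proof -
    obtain x where "norm x = 1" "\<And>l. l < r \<Longrightarrow> x \<bullet> u l = 0"
      using orthonormal_cols_extend[OF u] by metis
    then have "x \<in> K"
      by (simp add: K_def T_def)
    then show ?thesis
      by blast
  qed
  moreover have "continuous_on K (\<lambda>x. x \<bullet> (A *v x))"
    by (intro continuous_intros linear_continuous_on linear_conv_bounded_linear[THEN iffD1]) simp
  ultimately obtain x where x: "x \<in> K" and max: "\<And>y. y \<in> K \<Longrightarrow> y \<bullet> (A *v y) \<le> x \<bullet> (A *v x)"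
    using continuous_attains_sup by metis
  define \<nu> where "\<nu> = x \<bullet> (A *v x)"
  have x1: "x \<bullet> x = 1" and xT: "x \<in> T"
    using x by (auto simp: K_def norm_eq_1)
  have T_comb: "y + c *\<^sub>R z \<in> T" if "y \<in> T" "z \<in> T" for y z c
    using that by (simp add: T_def inner_add_left)
  \<comment> \<open>The complement \<open>T\<close> is invariant because \<open>A\<close> is
    symmetric and every \<open>u l\<close> is an eigenvector.\<close>
  have A_T: "A *v y \<in> T" if "y \<in> T" for y
  proof -
    have "(A *v y) \<bullet> u l = y \<bullet> (\<mu> l *\<^sub>R u l)" if "l < r" for l
      by (metis eig inner_commute sym that)
    then show ?thesis
      using that by (simp add: T_def)
  qed
  \<comment> \<open>The bound on the unit sphere extends to all of \<open>T\<close> by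
    homogeneity.\<close>
  have le: "y \<bullet> (A *v y) \<le> \<nu> * (y \<bullet> y)" if "y \<in> T" for y
  proof (cases "y = 0")
    case False
    have "y /\<^sub>R norm y \<in> K"
      using that False by (simp add: K_def T_def)
    from max[OF this] have "(y \<bullet> (A *v y)) / (norm y)\<^sup>2 \<le> \<nu>"
      by (simp add: \<nu>_def matrix_vector_mult_scaleR power2_eq_square field_simps)
    then show ?thesis
      using False by (simp add: field_simps power2_norm_eq_inner)
  qed simp
  \<comment> \<open>Moving from the maximizer \<open>x\<close> in a direction \<open>y\<close> of
    \<open>T\<close> keeps \<open>le\<close> valid. The constant term cancels by the choice of
    \<nu>, so the linear term must vanish.\<close>
  have "y \<bullet> (\<nu> *\<^sub>R x - A *v x) = 0" if "y \<in> T" for y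
  proof (rule linear_term_zero)
    fix t :: real
    have "0 \<le> \<nu> * ((x + t *\<^sub>R y) \<bullet> (x + t *\<^sub>R y)) - (x + t *\<^sub>R y) \<bullet> (A *v (x + t *\<^sub>R y))"
      using le[OF T_comb[OF xT that]] by simp
    also have "\<dots> = 2 * t * (y \<bullet> (\<nu> *\<^sub>R x - A *v x)) + t\<^sup>2 * (\<nu> * (y \<bullet> y) - y \<bullet> (A *v y))"
      using x1 sym[of x y]
      by (simp add: algebra_simps matrix_vector_mult_scaleR inner_commute[of x y] power2_eq_square
          \<nu>_def[symmetric] matrix_vector_right_distrib inner_diff_right)
    finally show "0 \<le> 2 * t * (y \<bullet> (\<nu> *\<^sub>R x - A *v x)) + t\<^sup>2 * (\<nu> * (y \<bullet> y) - y \<bullet> (A *v y))" .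
  qed
  \<comment> \<open>The residual lies in \<open>T\<close> itself, so it may be taken for
    \<open>y\<close> and is orthogonal to itself.\<close>
  moreover have "\<nu> *\<^sub>R x - A *v x \<in> T"
    using xT A_T[OF xT] by (simp add: T_def inner_diff_left)
  ultimately have "A *v x = \<nu> *\<^sub>R x"
    by (metis eq_iff_diff_eq_0 inner_eq_zero_iff)
  then show thesis
    using x by (intro that[of x \<nu>]) (auto simp: K_def T_def)
qed

text \<open>The basis grows one vector at a time: \<open>eigenvector_extend\<close> applies as long
  as fewer than \<open>CARD('m)\<close> eigenvectors have been found.\<close>

lemma symmetric_eigenbasis:
  fixes A :: "real^'m^'m"
  assumes "transpose A = A"
  obtains u \<mu> where "orthonormal_cols CARD('m) u"
    and "\<And>k. k < CARD('m) \<Longrightarrow> A *v u k = \<mu> k *\<^sub>R u k"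
proof -
  have "\<exists>u \<mu>. orthonormal_cols r u \<and> (\<forall>k<r. A *v u k = \<mu> k *\<^sub>R u k)" if "r \<le> CARD('m)" for r
    using that
  proof (induction r)
    case 0
    show ?case
      by (simp add: orthonormal_cols_def)
  next
    case (Suc r)
    then obtain u \<mu> where u: "orthonormal_cols r u" "\<And>k. k < r \<Longrightarrow> A *v u k = \<mu> k *\<^sub>R u k"
      by auto
    obtain x \<nu> where x: "norm x = 1" "\<And>l. l < r \<Longrightarrow> x \<bullet> u l = 0" "A *v x = \<nu> *\<^sub>R x"
      using eigenvector_extend[OF assms u(1) _ u(2)] Suc.prems by auto
    have "orthonormal_cols (Suc r) (u(r := x))"
      using u(1) x(1,2) by (auto simp: orthonormal_cols_def less_Suc_eq norm_eq_1 inner_commute)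
    moreover have "\<forall>k<Suc r. A *v (u(r := x)) k = (\<mu>(r := \<nu>)) k *\<^sub>R (u(r := x)) k"
      using u(2) x(3) by (auto simp: less_Suc_eq)
    ultimately show ?case
      by blast
  qed
  then show thesis
    using that by blast
qed

subsection \<open>Singular value decompositions and the matrix sign\<close>

text \<open>The product U S V^T written through columns. Constant weight 1 gives U V^T, and
  \<open>u = v\<close> gives a spectral decomposition, so all three share one calculus.\<close>

definition outer_sum ::
    "nat \<Rightarrow> (nat \<Rightarrow> real^'m) \<Rightarrow> (nat \<Rightarrow> real) \<Rightarrow> (nat \<Rightarrow> real^'n) \<Rightarrow> real^'n^'m" where
  "outer_sum r u s v = (\<chi> i j. \<Sum>k<r. u k $ i * s k * v k $ j)"

lemma transpose_outer_sum: "transpose (outer_sum r u s v) = outer_sum r v s u"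
  by (simp add: outer_sum_def transpose_def vec_eq_iff mult_ac)

lemma outer_sum_vector: "outer_sum r u s v *v x = (\<Sum>k<r. (s k * (v k \<bullet> x)) *\<^sub>R u k)"
proof -
  have "(\<Sum>j\<in>UNIV. (\<Sum>k<r. u k $ i * s k * v k $ j) * x $ j) =
      (\<Sum>k<r. s k * (\<Sum>j\<in>UNIV. v k $ j * x $ j) * u k $ i)" for i
    by (simp add: sum_distrib_right sum_distrib_left mult_ac, subst sum.swap, simp)
  then show ?thesis
    by (simp add: outer_sum_def matrix_vector_mult_def vec_eq_iff inner_vec_def)
qed

text \<open>The inner factor V^T V is the identity, so only the two diagonal matrices are left to
  multiply.\<close>

lemma outer_sum_mult:
  assumes "orthonormal_cols r v"
  shows "outer_sum r u s v ** outer_sum r v t w = outer_sum r u (\<lambda>k. s k * t k) w"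
proof -
  have "v k \<bullet> (\<Sum>l<r. (t l * (w l \<bullet> x)) *\<^sub>R v l) = t k * (w k \<bullet> x)" if "k < r" for k x
  proof -
    have "v k \<bullet> (\<Sum>l<r. (t l * (w l \<bullet> x)) *\<^sub>R v l) =
        (\<Sum>l<r. if k = l then t l * (w l \<bullet> x) else 0)"
      using assms that unfolding inner_sum_right orthonormal_cols_def
      by (intro sum.cong) auto
    then show ?thesis
      using that by simp
  qed
  then show ?thesis
    by (auto simp: matrix_eq matrix_vector_mul_assoc[symmetric] outer_sum_vector mult_ac
        intro!: sum.cong)
qed

lemma matrix_mult_outer_sum: "A ** outer_sum r u s v = outer_sum r (\<lambda>k. A *v u k) s v"
  by (simp add: matrix_eq matrix_vector_mul_assoc[symmetric] outer_sum_vector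
      linear_sum[OF matrix_vector_mul_linear] matrix_vector_mult_scaleR)

lemma outer_sum_mult_matrix:
  "outer_sum r u s v ** A = outer_sum r u s (\<lambda>k. transpose A *v v k)"
  by (simp add: matrix_eq matrix_vector_mul_assoc[symmetric] outer_sum_vector dot_lmul_matrix)

text \<open>For a square U, this upgrades U^T U = I to U U^T = I: what remains of \<open>x\<close>
  after subtracting its components is orthogonal to the full orthonormal system.\<close>

lemma orthonormal_cols_complete:
  fixes u :: "nat \<Rightarrow> real^'m"
  assumes "orthonormal_cols CARD('m) u"
  shows "outer_sum CARD('m) u (\<lambda>_. 1) u = mat 1"
proof -
  have "x - (\<Sum>k<CARD('m). (u k \<bullet> x) *\<^sub>R u k) = 0" for x
  proof (rule orthonormal_cols_orthogonal_zero[OF assms])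
    fix l assume l: "l < CARD('m)"
    have "(\<Sum>k<CARD('m). (u k \<bullet> x) *\<^sub>R u k) \<bullet> u l =
        (\<Sum>k<CARD('m). if k = l then u k \<bullet> x else 0)"
      using assms l unfolding inner_sum_left orthonormal_cols_def by (intro sum.cong) auto
    then show "(x - (\<Sum>k<CARD('m). (u k \<bullet> x) *\<^sub>R u k)) \<bullet> u l = 0"
      using l by (simp add: inner_diff_left) (simp add: inner_commute)
  qed
  then show ?thesis
    by (simp add: matrix_eq outer_sum_vector)
qed

lemma compact_svd_iff:
  "compact_svd X u s v \<longleftrightarrow> orthonormal_cols (rank X) u \<and> orthonormal_cols (rank X) v \<and>
     (\<forall>k<rank X. s k > 0) \<and> X = outer_sum (rank X) u s v"
  by (simp add: compact_svd_def outer_sum_def)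

lemma msgn_outer_sum:
  "msgn X = (THE M. \<exists>u s v. compact_svd X u s v \<and> M = outer_sum (rank X) u (\<lambda>_. 1) v)"
  by (simp add: msgn_def outer_sum_def)

text \<open>An eigenbasis of \<open>H\<close> yields one decomposition of \<open>H ** D\<close>
  whose sign is \<open>D\<close>. Any other decomposition contains a positive semidefinite square
  root of \<open>H ** H\<close>, which must be \<open>H\<close>, and cancelling \<open>H\<close>
  leaves \<open>D\<close> again.\<close>

lemma msgn_polar:
  fixes H :: "real^'m^'m" and D :: "real^'n^'m"
  assumes H: "pos_def H" and D: "D ** transpose D = mat 1"
  shows "msgn (H ** D) = D"
proof -
  let ?X = "H ** D" and ?m = "CARD('m)"
  have H_sym: "transpose H = H" and H_inv: "invertible H"
    using H pos_def_invertible by (auto simp: pos_def_def)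
  \<comment> \<open>The right inverse D^T H^-1 shows that the matrix is surjective, so each of its
    compact decompositions has exactly \<open>CARD('m)\<close> terms.\<close>
  have rank: "rank ?X = ?m"
  proof -
    obtain H' where "H ** H' = mat 1"
      using H_inv unfolding invertible_def by blast
    then have "?X ** (transpose D ** H') = mat 1"
      by (metis D matrix_mul_assoc matrix_mul_rid)
    then show ?thesis
      unfolding full_rank_surjective by (metis matrix_right_invertible_surjective)
  qed
  obtain u \<mu> where u: "orthonormal_cols ?m u" and eig: "\<And>k. k < ?m \<Longrightarrow> H *v u k = \<mu> k *\<^sub>R u k"
    using symmetric_eigenbasis[OF H_sym] by metis
  \<comment> \<open>Chosen so that U V^T = U U^T D = D.\<close>
  define v where "v k = transpose D *v u k" for k
  have \<mu>_pos: "\<mu> k > 0" if "k < ?m" for k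
  proof -
    have "u k \<bullet> u k = 1"
      using u that by (simp add: orthonormal_cols_def)
    moreover from this have "u k \<noteq> 0"
      by auto
    ultimately show ?thesis
      using H eig[OF that] unfolding pos_def_def by (metis inner_scaleR_right mult.right_neutral)
  qed
  have v: "orthonormal_cols ?m v"
  proof -
    have "v k \<bullet> v l = u k \<bullet> u l" for k l
      unfolding v_def inner_matrix_vector by (simp only: transpose_transpose matrix_vector_mul_assoc D matrix_vector_mul_lid)
    then show ?thesis
      using u by (simp add: orthonormal_cols_def)
  qed
  have D_eq: "D = outer_sum ?m u (\<lambda>_. 1) v"
    using orthonormal_cols_complete[OF u] outer_sum_mult_matrix[of ?m u "\<lambda>_. 1" u D]
    by (simp add: v_def[abs_def])
  have X_eq: "?X = outer_sum ?m u \<mu> v"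
    by (subst D_eq) (simp add: matrix_mult_outer_sum, simp add: outer_sum_def eig mult_ac)
  have svd: "compact_svd ?X u \<mu> v"
    unfolding compact_svd_iff rank using u v \<mu>_pos X_eq by simp
  show ?thesis
    unfolding msgn_outer_sum rank
  proof (rule the_equality)
    show "\<exists>u s v. compact_svd ?X u s v \<and> D = outer_sum ?m u (\<lambda>_. 1) v"
      using svd D_eq by blast
    fix M
    assume "\<exists>u s v. compact_svd ?X u s v \<and> M = outer_sum ?m u (\<lambda>_. 1) v"
    then obtain a s b where ab: "orthonormal_cols ?m a" "orthonormal_cols ?m b"
      and s: "\<And>k. k < ?m \<Longrightarrow> s k > 0" and X: "?X = outer_sum ?m a s b"
      and M: "M = outer_sum ?m a (\<lambda>_. 1) b"
      unfolding compact_svd_iff rank by blast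
    \<comment> \<open>The left polar factor of the given decomposition: its square is X X^T, and
      \<open>P ** M\<close> is X.\<close>
    define P where "P = outer_sum ?m a s a"
    have "P = H"
    proof (rule psd_sqrt_unique[OF _ _ H])
      show "transpose P = P"
        by (simp add: P_def transpose_outer_sum)
      show "0 \<le> x \<bullet> (P *v x)" for x
        unfolding P_def outer_sum_vector inner_sum_right
        by (rule sum_nonneg)
          (use s in \<open>auto simp: inner_commute[of x] mult.assoc less_imp_le intro!: mult_nonneg_nonneg\<close>)
      have "P ** P = ?X ** transpose ?X"
        by (simp add: P_def X transpose_outer_sum outer_sum_mult ab)
      also have "\<dots> = H ** (D ** transpose D) ** transpose H"
        by (simp add: matrix_transpose_mul matrix_mul_assoc)
      finally show "P ** P = H ** H"
        by (simp add: D H_sym)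
    qed
    moreover have "P ** M = ?X"
      unfolding X by (simp add: P_def M outer_sum_mult ab)
    ultimately show "M = D"
      using invertible_mult_left_cancel[OF H_inv] by blast
  qed
qed

subsection \<open>The quadratic objective\<close>

text \<open>By \<open>G_eq\<close> the linear term is the bilinear form of the quadratic term with
  one argument fixed at \<open>D\<close>, so expanding around \<open>D\<close> leaves no first-order
  term.\<close>

lemma quad_obj_complete_square:
  fixes D G Q :: "real^'n^'m" and Z :: "real^'N^'n" and H :: "real^'m^'m"
  assumes H_sym: "transpose H = H"
    and G_eq: "G = (1 / real CARD('N)) *\<^sub>R (H ** D ** (Z ** transpose Z))"
  shows "quad_obj H Z G Q = quad_obj H Z G D
    + 1 / (2 * real CARD('N)) * trace (transpose ((Q - D) ** Z) ** H ** ((Q - D) ** Z))"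
proof -
  define q where "q R S = trace (H ** R ** (Z ** transpose Z) ** transpose S)" for R S :: "real^'n^'m"
  \<comment> \<open>Transposing inside the trace swaps the arguments, since both \<open>H\<close>
    and \<open>Z ** transpose Z\<close> are symmetric.\<close>
  have q_sym: "q R S = q S R" for R S
  proof -
    have "q R S = trace (transpose (H ** R ** (Z ** transpose Z) ** transpose S))"
      by (simp add: q_def trace_transpose)
    also have "\<dots> = trace ((S ** (Z ** transpose Z) ** transpose R) ** H)"
      by (simp add: matrix_transpose_mul H_sym matrix_mul_assoc)
    also have "\<dots> = q S R"
      by (subst trace_mul_sym) (simp add: q_def matrix_mul_assoc)
    finally show ?thesis .
  qed
  have lin: "trace (R ** transpose G) = q D R / real CARD('N)" for R
    by (subst trace_transpose[symmetric])
      (simp add: matrix_transpose_mul G_eq q_def scaleR_matrix_mult trace_scaleR)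
  have obj: "quad_obj H Z G R = - (q D R / real CARD('N)) + q R R / (2 * real CARD('N))" for R
    unfolding quad_obj_def lin by (simp add: q_def)
  have "trace (transpose ((Q - D) ** Z) ** H ** ((Q - D) ** Z)) = q (Q - D) (Q - D)"
    unfolding q_def matrix_transpose_mul
    by (metis matrix_mul_assoc trace_mul_sym)
  also have "\<dots> = q Q Q - q Q D - q D Q + q D D"
    by (simp add: q_def transpose_diff matrix_diff_mult trace_sub)
  also have "\<dots> = q Q Q - 2 * q D Q + q D D"
    by (simp add: q_sym[of Q D])
  finally show ?thesis
    unfolding obj by (simp add: field_simps)
qed

theorem theorem1:
  fixes W Wstar G :: "real^'n^'m" and Z :: "real^'N^'n" and H :: "real^'m^'m"
  assumes H_sym: "transpose H = H"
    and H_pos: "pos_def H"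
    and Z_pos: "pos_def (Z ** transpose Z)"
    and G_eq: "G = (1 / real CARD('N)) *\<^sub>R (H ** (W - Wstar) ** (Z ** transpose Z))"
    and isotropic: "(W - Wstar) ** transpose (W - Wstar) \<propto> mat 1"
  shows "(\<exists>!Q. is_arg_min (quad_obj H Z G) (\<lambda>_. True) Q) \<and>
         (\<forall>Qstar. is_arg_min (quad_obj H Z G) (\<lambda>_. True) Qstar \<longrightarrow>
                  Qstar \<propto> msgn (G ** matrix_inv (Z ** transpose Z)))"
proof -
  define D where "D = W - Wstar"
  let ?A = "Z ** transpose Z" and ?N = "real CARD('N)"
  have A_inv: "?A ** matrix_inv ?A = mat 1"
    using pos_def_invertible[OF Z_pos] by (rule invertible_matrix_inv_right)
  note square = quad_obj_complete_square[OF H_sym G_eq, folded D_def]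
  have le: "quad_obj H Z G D \<le> quad_obj H Z G Q" for Q
    unfolding square[of Q] using pos_def_trace(1)[OF H_pos, of "(Q - D) ** Z"] by simp
  have eq: "Q = D" if "quad_obj H Z G Q \<le> quad_obj H Z G D" for Q
  proof -
    have "trace (transpose ((Q - D) ** Z) ** H ** ((Q - D) ** Z)) \<le> 0"
      using that unfolding square[of Q] by (simp add: divide_le_0_iff)
    then have "(Q - D) ** Z = 0"
      using pos_def_trace[OF H_pos, of "(Q - D) ** Z"] by (meson order_antisym)
    \<comment> \<open>Multiplying by Z^T and then by the inverse of Z Z^T removes
      \<open>Z\<close>.\<close>
    then have "(Q - D) ** ?A ** matrix_inv ?A = 0"
      by (simp add: matrix_mul_assoc)
    then have "(Q - D) ** (?A ** matrix_inv ?A) = 0"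
      by (simp only: matrix_mul_assoc)
    then show "Q = D"
      by (simp add: A_inv)
  qed
  have min_iff: "is_arg_min (quad_obj H Z G) (\<lambda>_. True) Q \<longleftrightarrow> Q = D" for Q
    unfolding is_arg_min_def using le eq by (meson not_le)
  obtain c where c: "c > 0" "D ** transpose D = c *\<^sub>R mat 1"
    using isotropic unfolding propto_def D_def by blast
  \<comment> \<open>Dividing by \<open>sqrt c\<close> turns
    \<open>D ** transpose D = c *\<^sub>R mat 1\<close> into orthonormality of the rows.\<close>
  define D' where "D' = (1 / sqrt c) *\<^sub>R D"
  have D: "D = sqrt c *\<^sub>R D'"
    using c(1) by (simp add: D'_def)
  have D'_orth: "D' ** transpose D' = mat 1"
    using c by (simp add: D'_def transpose_scalar scaleR_matrix_mult)
  have "G ** matrix_inv ?A = (1 / ?N) *\<^sub>R (H ** D ** (?A ** matrix_inv ?A))"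
    by (simp add: G_eq D_def scaleR_matrix_mult matrix_mul_assoc)
  \<comment> \<open>The positive factor \<open>sqrt c / ?N\<close> is absorbed into
    \<open>H\<close>, which stays positive definite, so that \<open>msgn_polar\<close>
    applies.\<close>
  also have "\<dots> = ((sqrt c / ?N) *\<^sub>R H) ** D'"
    by (simp add: A_inv D scaleR_matrix_mult)
  finally have "msgn (G ** matrix_inv ?A) = D'"
    using msgn_polar[OF pos_def_scaleR[OF H_pos] D'_orth, of "sqrt c / ?N"] c(1) by simp
  then have "D \<propto> msgn (G ** matrix_inv ?A)"
    unfolding propto_def using D c(1) by (intro exI[of _ "sqrt c"]) simp
  then show ?thesis
    by (simp add: min_iff)
qed

end
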